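(* Let $G$ be a finite simple graph that is prime and belongs to DH $\cap$ co-DH. Then $G$ is isomorphic to $P_4$ or to the Bull.
   Context: All graphs are finite and simple. A graph is distance-hereditary if it has no induced subgraph isomorphic to a hole (an induced cycle of length at least $5$), the house (a $5$-cycle plus one chord; equivalently the complement of $P_5$), the domino (a $6$-cycle $v_1v_2\dots v_6$ plus the chord $v_1v_4$), or the gem (a path $P_4$ plus one vertex adjacent to all four of its vertices). DH $\cap$ co-DH denotes the class of graphs $G$ such that both $G$ and its complement $\overline{G}$ are distance-hereditary. A module of $G=(V,E)$ is a set $M\subseteq V$ such that every $v\in V\setminus M$ is adjacent either to all vertices of $M$ or to none of them; a module is trivial if $|M|=1$ or $M=V$. A graph is prime if all its modules are trivial. $P_4$ is the path on $4$ vertices. The Bull is the graph on vertices $a,b,c,d,e$ with edges $ab,bc,ca,ad,be$.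
   Formalization: The graph is assumed to have at least 3 vertices, since graphs on one or two vertices (such as a single edge) are prime and in DH ∩ co-DH but are neither P4 nor the Bull; the empty set is not counted as a module. *)

theory Defs
  imports Main
begin

definition simple_graph :: "'a set \<Rightarrow> ('a \<Rightarrow> 'a \<Rightarrow> bool) \<Rightarrow> bool" where
  "simple_graph V E \<longleftrightarrow> finite V \<and> (\<forall>x\<in>V. \<forall>y\<in>V. E x y \<longleftrightarrow> E y x) \<and> (\<forall>x\<in>V. \<not> E x x)"

definition compl_graph :: "('a \<Rightarrow> 'a \<Rightarrow> bool) \<Rightarrow> 'a \<Rightarrow> 'a \<Rightarrow> bool" where
  "compl_graph E x y \<longleftrightarrow> x \<noteq> y \<and> \<not> E x y"

definition induced_sub :: "'b set \<Rightarrow> ('b \<Rightarrow> 'b \<Rightarrow> bool) \<Rightarrow> 'a set \<Rightarrow> ('a \<Rightarrow> 'a \<Rightarrow> bool) \<Rightarrow> bool" where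
  "induced_sub W F V E \<longleftrightarrow> (\<exists>f. inj_on f W \<and> f ` W \<subseteq> V \<and>
      (\<forall>x\<in>W. \<forall>y\<in>W. F x y \<longleftrightarrow> E (f x) (f y)))"

definition graph_iso :: "'a set \<Rightarrow> ('a \<Rightarrow> 'a \<Rightarrow> bool) \<Rightarrow> 'b set \<Rightarrow> ('b \<Rightarrow> 'b \<Rightarrow> bool) \<Rightarrow> bool" where
  "graph_iso V E W F \<longleftrightarrow> (\<exists>f. bij_betw f V W \<and> (\<forall>x\<in>V. \<forall>y\<in>V. E x y \<longleftrightarrow> F (f x) (f y)))"

definition edges_of :: "(nat \<times> nat) list \<Rightarrow> nat \<Rightarrow> nat \<Rightarrow> bool" where
  "edges_of es x y \<longleftrightarrow> (x, y) \<in> set es \<or> (y, x) \<in> set es"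

definition cycle_edges :: "nat \<Rightarrow> nat \<Rightarrow> nat \<Rightarrow> bool" where
  "cycle_edges n x y \<longleftrightarrow> x < n \<and> y < n \<and> (y = (x + 1) mod n \<or> x = (y + 1) mod n)"

definition house :: "nat \<Rightarrow> nat \<Rightarrow> bool" where
  "house = edges_of [(0,1),(1,2),(2,3),(3,4),(4,0),(0,2)]"

definition domino :: "nat \<Rightarrow> nat \<Rightarrow> bool" where
  "domino = edges_of [(0,1),(1,2),(2,3),(3,4),(4,5),(5,0),(0,3)]"

definition gem :: "nat \<Rightarrow> nat \<Rightarrow> bool" where
  "gem = edges_of [(0,1),(1,2),(2,3),(4,0),(4,1),(4,2),(4,3)]"

definition P4 :: "nat \<Rightarrow> nat \<Rightarrow> bool" where
  "P4 = edges_of [(0,1),(1,2),(2,3)]"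

definition bull :: "nat \<Rightarrow> nat \<Rightarrow> bool" where
  "bull = edges_of [(0,1),(1,2),(2,0),(0,3),(1,4)]"

definition distance_hereditary :: "'a set \<Rightarrow> ('a \<Rightarrow> 'a \<Rightarrow> bool) \<Rightarrow> bool" where
  "distance_hereditary V E \<longleftrightarrow>
     (\<forall>n\<ge>5. \<not> induced_sub {0..<n} (cycle_edges n) V E) \<and>
     \<not> induced_sub {0..<5} house V E \<and>
     \<not> induced_sub {0..<6} domino V E \<and>
     \<not> induced_sub {0..<5} gem V E"

definition is_module :: "'a set \<Rightarrow> ('a \<Rightarrow> 'a \<Rightarrow> bool) \<Rightarrow> 'a set \<Rightarrow> bool" where
  "is_module V E M \<longleftrightarrow> M \<subseteq> V \<and>
     (\<forall>v\<in>V - M. (\<forall>m\<in>M. E v m) \<or> (\<forall>m\<in>M. \<not> E v m))"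

definition prime_graph :: "'a set \<Rightarrow> ('a \<Rightarrow> 'a \<Rightarrow> bool) \<Rightarrow> bool" where
  "prime_graph V E \<longleftrightarrow> (\<forall>M. is_module V E M \<and> M \<noteq> {} \<longrightarrow> card M = 1 \<or> M = V)"

end

theory Submission
  imports Defs
begin

text \<open>
  In a DH graph, no vertex sees both ends of an induced path \<open>a b c d\<close> (this would give \<open>C\<^sub>5\<close>, a
  house or a gem). The complement of the path is the path \<open>b d a c\<close>, so in DH \<open>\<inter>\<close> co-DH every
  vertex moreover sees one of the midpoints \<open>b\<close>, \<open>c\<close>. A prime graph on at least three vertices
  contains an induced \<open>P\<^sub>4\<close>, since a \<open>P\<^sub>4\<close>-free graph or its complement is disconnected; blow it up to pairwise disjoint sets \<open>A\<close>, \<open>B\<close>, \<open>C\<close>, \<open>D\<close>, adjacent to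
  each other as \<open>a\<close>, \<open>b\<close>, \<open>c\<close>, \<open>d\<close> are, with \<open>A \<union> B \<union> C \<union> D\<close> as large as possible. The two rules
  force every remaining vertex to see exactly \<open>B \<union> C\<close> there, so \<open>A\<close>, \<open>B\<close>, \<open>C\<close>, \<open>D\<close> and the
  set of remaining vertices are all modules, and primality makes them singletons or empty.
\<close>

section \<open>Induced paths on four vertices\<close>

text \<open>For a symmetric irreflexive \<open>E\<close>, the six conditions force the four vertices to be distinct.\<close>

definition induced_P4 :: "('a \<Rightarrow> 'a \<Rightarrow> bool) \<Rightarrow> 'a \<Rightarrow> 'a \<Rightarrow> 'a \<Rightarrow> 'a \<Rightarrow> bool" where
  "induced_P4 E a b c d \<longleftrightarrow>
     E a b \<and> E b c \<and> E c d \<and> \<not> E a c \<and> \<not> E b d \<and> \<not> E a d"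

lemma simple_graph_sym: "simple_graph V E \<Longrightarrow> x \<in> V \<Longrightarrow> y \<in> V \<Longrightarrow> E x y = E y x"
  by (auto simp: simple_graph_def)

lemma simple_graph_irrefl: "simple_graph V E \<Longrightarrow> x \<in> V \<Longrightarrow> \<not> E x x"
  by (auto simp: simple_graph_def)

lemma simple_graph_compl: "simple_graph V E \<Longrightarrow> simple_graph V (compl_graph E)"
  by (auto simp: simple_graph_def compl_graph_def)

lemma compl_compl_graph: "simple_graph V E \<Longrightarrow> x \<in> V \<Longrightarrow> compl_graph (compl_graph E) x y = E x y"
  by (auto simp: simple_graph_def compl_graph_def)

lemma simple_graph_mono: "simple_graph V E \<Longrightarrow> W \<subseteq> V \<Longrightarrow> simple_graph W E"
  by (auto simp: simple_graph_def intro: finite_subset)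

lemma induced_P4_distinct:
  assumes "simple_graph V E" "{a, b, c, d} \<subseteq> V" "induced_P4 E a b c d"
  shows "distinct [a, b, c, d]"
proof -
  have "E b a" "E c b" "E d c" "\<not> E c a" "\<not> E d b" "\<not> E d a"
    using assms simple_graph_sym[OF assms(1)] by (auto simp: induced_P4_def)
  with assms(3) show ?thesis
    by (auto simp: induced_P4_def)
qed

lemma induced_P4_compl:
  assumes "simple_graph V E" "{a, b, c, d} \<subseteq> V" "induced_P4 E a b c d"
  shows "induced_P4 (compl_graph E) b d a c"
  using assms induced_P4_distinct[OF assms] simple_graph_sym[OF assms(1)]
  by (auto simp: induced_P4_def compl_graph_def)

lemma induced_P4_of_compl:
  assumes "simple_graph V E" "{a, b, c, d} \<subseteq> V" "induced_P4 (compl_graph E) a b c d"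
  shows "induced_P4 E b d a c"
  using induced_P4_compl[OF simple_graph_compl[OF assms(1)] assms(2,3)] assms(2)
  by (simp add: induced_P4_def compl_compl_graph[OF assms(1)])

section \<open>Adjacency of a further vertex to an induced path on four vertices\<close>

lemma five_vertex_set: "{0..<5} = {0, 1, 2, 3, 4 :: nat}"
  by (simp add: atLeast0LessThan eval_nat_numeral lessThan_Suc insert_commute)

text \<open>If \<open>v\<close> saw both ends, the path would close to a 5-cycle through
  \<open>v\<close>. Its only possible chords are \<open>v b\<close> and \<open>v c\<close>; none,
  one or both of them give a hole, a house or a gem.\<close>

lemma dh_P4_ends:
  assumes sg: "simple_graph V E" and dh: "distance_hereditary V E"
    and P: "induced_P4 E a b c d" and V: "{a, b, c, d} \<subseteq> V" and v: "v \<in> V"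
  shows "\<not> (E v a \<and> E v d)"
proof
  assume vad: "E v a \<and> E v d"
  have ends: "\<not> E b d" "\<not> E a c" "\<not> E a d"
    using P by (auto simp: induced_P4_def)
  note irr = simple_graph_irrefl[OF sg]
  have sym: "E b a" "E c b" "E d c" "\<not> E c a" "\<not> E d b" "\<not> E d a" "E a v" "E d v"
      "E b v = E v b" "E c v = E v c"
    using P V v vad simple_graph_sym[OF sg] by (auto simp: induced_P4_def)
  have dist: "distinct [v, a, b, c, d]"
    using induced_P4_distinct[OF sg V P] vad ends sym irr V by auto
  have loops: "\<not> E v v" "\<not> E a a" "\<not> E b b" "\<not> E c c" "\<not> E d d"
    using irr V v by auto
  note facts = dist P V v vad sym loops
  note unfold = induced_sub_def five_vertex_set inj_on_def edges_of_def induced_P4_def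
  consider "\<not> E v b" "\<not> E v c" | "E v b" "\<not> E v c" | "\<not> E v b" "E v c" | "E v b" "E v c"
    by blast
  then show False
  proof cases
    case 1
    have "induced_sub {0..<5} (cycle_edges 5) V E"
      unfolding unfold by (rule exI[of _ "nth [v, a, b, c, d]"])
        (use 1 facts in \<open>auto simp: cycle_edges_def induced_P4_def\<close>)
    with dh show False by (auto simp: distance_hereditary_def)
  next
    case 2
    \<comment> \<open>Read from \<open>v\<close>, the cycle has the chord \<open>v b\<close> at
      positions 0 and 2, as in \<open>house\<close>; the mirrored case reads it backwards to put
      \<open>v c\<close> there.\<close>
    have "induced_sub {0..<5} house V E"
      unfolding unfold house_def by (rule exI[of _ "nth [v, a, b, c, d]"])
        (use 2 facts in \<open>auto simp: induced_P4_def\<close>)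
    with dh show False by (auto simp: distance_hereditary_def)
  next
    case 3
    have "induced_sub {0..<5} house V E"
      unfolding unfold house_def by (rule exI[of _ "nth [v, d, c, b, a]"])
        (use 3 facts in \<open>auto simp: induced_P4_def\<close>)
    with dh show False by (auto simp: distance_hereditary_def)
  next
    case 4
    have "induced_sub {0..<5} gem V E"
      unfolding unfold gem_def by (rule exI[of _ "nth [a, b, c, d, v]"])
        (use 4 facts in \<open>auto simp: induced_P4_def\<close>)
    with dh show False by (auto simp: distance_hereditary_def)
  qed
qed

text \<open>Complementation turns the midpoints \<open>b\<close> and \<open>c\<close> into the ends
  of a path, where the rule on ends applies. As \<open>compl_graph\<close> is irreflexive, the cases
  \<open>v = b\<close> and \<open>v = c\<close> rest on the edge \<open>b c\<close>.\<close>

lemma co_dh_P4_mids: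
  assumes sg: "simple_graph V E" and dh: "distance_hereditary V (compl_graph E)"
    and P: "induced_P4 E a b c d" and V: "{a, b, c, d} \<subseteq> V" and v: "v \<in> V"
  shows "E v b \<or> E v c"
proof -
  have "\<not> (compl_graph E v b \<and> compl_graph E v c)"
    using dh_P4_ends[OF simple_graph_compl[OF sg] dh induced_P4_compl[OF sg V P]] V v by auto
  moreover have "E b c" "E c b"
    using P V simple_graph_sym[OF sg] by (auto simp: induced_P4_def)
  ultimately show ?thesis
    by (auto simp: compl_graph_def)
qed

section \<open>Prime graphs contain an induced path on four vertices\<close>

text \<open>For a symmetric \<open>E\<close> this is disconnectedness, phrased without walks so that
  it can be used alike for a graph and its complement.\<close>

definition splits :: "('a \<Rightarrow> 'a \<Rightarrow> bool) \<Rightarrow> 'a set \<Rightarrow> bool" where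
  "splits E V \<longleftrightarrow> (\<exists>A B. A \<noteq> {} \<and> B \<noteq> {} \<and> A \<inter> B = {} \<and> A \<union> B = V \<and> (\<forall>x\<in>A. \<forall>y\<in>B. \<not> E x y))"

lemma splitsI:
  assumes "A \<subseteq> V" "A \<noteq> {}" "A \<noteq> V" "\<And>x y. x \<in> A \<Longrightarrow> y \<in> V - A \<Longrightarrow> \<not> E x y"
  shows "splits E V"
  unfolding splits_def using assms by (intro exI[of _ A] exI[of _ "V - A"]) auto

text \<open>If neither graph splits, \<open>v\<close> has a non-neighbour on one side of the old
  split, and from it an induced path leads through a neighbour of \<open>v\<close> on that side and
  through \<open>v\<close> to the other side.\<close>

lemma splits_insert:
  assumes sg: "simple_graph (insert v V) E" and v: "v \<notin> V" and split: "splits E V"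
    and noP4: "\<And>a b c d. {a, b, c, d} \<subseteq> insert v V \<Longrightarrow> \<not> induced_P4 E a b c d"
  shows "splits E (insert v V) \<or> splits (compl_graph E) (insert v V)"
proof (rule ccontr)
  assume no: "\<not> ?thesis"
  note sym = simple_graph_sym[OF sg]
  have False if AB: "A \<noteq> {}" "B \<noteq> {}" "A \<inter> B = {}" "A \<union> B = V" "\<forall>x\<in>A. \<forall>y\<in>B. \<not> E x y"
    and y: "y0 \<in> A" "\<not> E v y0" for A B y0
  proof -
    let ?M = "{y \<in> A. \<not> E v y}"
    have M: "?M \<subseteq> insert v V" "?M \<noteq> {}" "?M \<noteq> insert v V"
      using AB v y by auto
    \<comment> \<open>Some edge leaves \<open>?M\<close>. It reaches neither \<open>B\<close> nor
      \<open>v\<close>, so it ends at a neighbour of \<open>v\<close> in \<open>A\<close>.\<close>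
    have "\<exists>y\<in>?M. \<exists>x\<in>insert v V - ?M. E y x"
      using splitsI[of ?M "insert v V" E] M no by blast
    then obtain x y where xy: "y \<in> A" "\<not> E v y" "x \<in> insert v V" "x \<notin> ?M" "E y x"
      by blast
    then have x: "x \<in> A" "E v x"
      using AB sym[of y v] by auto
    \<comment> \<open>An edge leaving \<open>B\<close> cannot enter \<open>A\<close>, so it ends at
      \<open>v\<close>.\<close>
    have "\<exists>z\<in>B. \<exists>w\<in>insert v V - B. E z w"
      using splitsI[of B "insert v V" E] AB v no by blast
    then obtain z w where zw: "z \<in> B" "w \<in> insert v V" "w \<notin> B" "E z w"
      by blast
    then have "w \<notin> A"
      using AB sym[of z w] by auto
    with zw AB have z: "z \<in> B" "E z v"
      by auto
    have "induced_P4 E y x v z"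
      using xy x z AB sym[of v x] sym[of v z] sym[of v y] by (auto simp: induced_P4_def)
    then show False
      using noP4[of y x v z] xy x z AB by auto
  qed
  note key = this
  obtain A B where AB: "A \<noteq> {}" "B \<noteq> {}" "A \<inter> B = {}" "A \<union> B = V" "\<forall>x\<in>A. \<forall>y\<in>B. \<not> E x y"
    using split unfolding splits_def by blast
  have BA: "\<forall>x\<in>B. \<forall>y\<in>A. \<not> E x y"
  proof (intro ballI)
    show "\<not> E x y" if "x \<in> B" "y \<in> A" for x y
      using AB that sym[of x y] by auto
  qed
  \<comment> \<open>Otherwise \<open>v\<close> would be isolated in the complement, which would then
    split.\<close>
  have "\<exists>y\<in>V. \<not> E v y"
    using splitsI[of "{v}" "insert v V" "compl_graph E"] no v AB by (auto simp: compl_graph_def)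
  then obtain y where y: "y \<in> V" "\<not> E v y"
    by blast
  show False
  proof (cases "y \<in> A")
    case True
    then show False
      using key[OF AB] y by blast
  next
    case False
    then have "y \<in> B"
      using y AB by blast
    moreover have "B \<inter> A = {}" "B \<union> A = V"
      using AB by blast+
    ultimately show False
      using key[OF AB(2,1) _ _ BA] y by blast
  qed
qed

lemma splits_cong:
  assumes "\<And>x y. x \<in> V \<Longrightarrow> y \<in> V \<Longrightarrow> E x y = F x y"
  shows "splits E V = splits F V"
proof -
  have "(\<forall>x\<in>A. \<forall>y\<in>B. \<not> E x y) = (\<forall>x\<in>A. \<forall>y\<in>B. \<not> F x y)" if "A \<union> B = V" for A B
    using assms that by (metis UnI1 UnI2)
  then show ?thesis
    unfolding splits_def by metis
qed

text \<open>Seinsche's theorem on cographs, by adding one vertex at a time. Hypothesis and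
  conclusion are invariant under complementation, so \<open>splits_insert\<close> serves both cases
  of the induction hypothesis.\<close>

lemma P4_free_splits:
  assumes "finite V" "simple_graph V E" "card V \<ge> 2"
    and "\<And>a b c d. {a, b, c, d} \<subseteq> V \<Longrightarrow> \<not> induced_P4 E a b c d"
  shows "splits E V \<or> splits (compl_graph E) V"
  using assms
proof (induction V rule: finite_induct)
  case empty
  then show ?case by simp
next
  case (insert v V)
  show ?case
  proof (cases "card V \<ge> 2")
    case True
    note sg = insert.prems(1) and noP4 = insert.prems(3)
    have "simple_graph V E"
      using sg by (rule simple_graph_mono) auto
    from insert.IH[OF this True noP4] consider "splits E V" | "splits (compl_graph E) V"
      by auto
    then show ?thesis
    proof cases
      case 1
      then show ?thesis
        using splits_insert[OF sg insert.hyps(2) _ noP4] by simp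
    next
      case 2
      have noP4': "\<not> induced_P4 (compl_graph E) a b c d" if "{a, b, c, d} \<subseteq> insert v V" for a b c d
        using induced_P4_of_compl[OF sg that] noP4[of b d a c] that by auto
      then have "splits (compl_graph E) (insert v V) \<or>
          splits (compl_graph (compl_graph E)) (insert v V)"
        using splits_insert[OF simple_graph_compl[OF sg] insert.hyps(2) 2 noP4'] by simp
      \<comment> \<open>The double complement agrees with \<open>E\<close> only from vertices of the
        graph, where \<open>E\<close> is irreflexive, so the two relations need not be
        equal.\<close>
      moreover have "splits (compl_graph (compl_graph E)) (insert v V) = splits E (insert v V)"
        by (rule splits_cong) (rule compl_compl_graph[OF sg])
      ultimately show ?thesis
        by blast
    qed
  next
    case False
    then have "card V = 1"
      using insert by simp
    then obtain u where "V = {u}"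
      by (auto simp: card_1_singleton_iff)
    with insert.hyps have u: "{v} \<noteq> insert v V" "insert v V - {v} = {u}"
      by auto
    have "splits F (insert v V)" if "\<not> F v u" for F
      by (rule splitsI[of "{v}"]) (use u that in auto)
    from this[of E] this[of "compl_graph E"] show ?thesis
      by (cases "E v u") (simp_all add: compl_graph_def[of E v u])
  qed
qed

text \<open>\<open>N\<close> names the outside vertices that see all of \<open>M\<close>; only
  \<open>N - M\<close> matters, so it may overlap \<open>M\<close>.\<close>

lemma is_moduleI:
  assumes "M \<subseteq> V" "\<And>v m. v \<in> N - M \<Longrightarrow> m \<in> M \<Longrightarrow> E v m"
    and "\<And>v m. v \<in> V - M - N \<Longrightarrow> m \<in> M \<Longrightarrow> \<not> E v m"
  shows "is_module V E M"
  unfolding is_module_def using assms by blast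

lemma prime_graphD:
  "prime_graph V E \<Longrightarrow> is_module V E M \<Longrightarrow> M \<noteq> {} \<Longrightarrow> M \<noteq> V \<Longrightarrow> card M = 1"
  by (auto simp: prime_graph_def)

text \<open>Both sides of a split, of the graph or of its complement, are proper modules. Primality
  makes them singletons, leaving only two vertices.\<close>

lemma prime_graph_has_P4:
  assumes sg: "simple_graph V E" and card: "card V \<ge> 3" and prime: "prime_graph V E"
  shows "\<exists>a b c d. {a, b, c, d} \<subseteq> V \<and> induced_P4 E a b c d"
proof (rule ccontr)
  assume "\<not> ?thesis"
  then have noP4: "\<not> induced_P4 E a b c d" if "{a, b, c, d} \<subseteq> V" for a b c d
    using that by blast
  have fin: "finite V"
    using sg by (simp add: simple_graph_def)
  have "splits E V \<or> splits (compl_graph E) V"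
    using P4_free_splits[OF fin sg _ noP4] card by simp
  then obtain F A B where F: "F = E \<or> F = compl_graph E"
    and AB: "A \<noteq> {}" "B \<noteq> {}" "A \<inter> B = {}" "A \<union> B = V" "\<forall>x\<in>A. \<forall>y\<in>B. \<not> F x y"
    unfolding splits_def by blast
  have BA: "\<forall>x\<in>B. \<forall>y\<in>A. \<not> F x y"
    using AB F simple_graph_sym[OF sg] simple_graph_sym[OF simple_graph_compl[OF sg]] by blast
  from F have "is_module V E A \<and> is_module V E B"
  proof
    assume F: "F = E"
    show ?thesis
      by (intro conjI is_moduleI[where N = "{}"]) (use F AB BA in blast)+
  next
    assume F: "F = compl_graph E"
    have "E x y \<and> E y x" if "x \<in> A" "y \<in> B" for x y
    proof -
      have "x \<noteq> y"
        using AB that by blast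
      then show ?thesis
        using F AB BA that by (auto simp: compl_graph_def)
    qed
    then show ?thesis
      by (intro conjI is_moduleI[where N = V]) (use AB in blast)+
  qed
  then have "card A = 1" "card B = 1"
    using prime_graphD[OF prime] AB by blast+
  moreover have "card V = card A + card B"
    using AB fin by (metis card_Un_disjoint finite_Un)
  ultimately show False
    using card by simp
qed

section \<open>Blow-ups of a path on four vertices\<close>

text \<open>Edges inside each set are unrestricted. Nonemptiness lets the condition on transversals
  determine every pair taken from two different sets, and disjointness then follows.\<close>

definition P4_blowup where
  "P4_blowup V E A B C D \<longleftrightarrow> A \<noteq> {} \<and> B \<noteq> {} \<and> C \<noteq> {} \<and> D \<noteq> {} \<and> A \<union> B \<union> C \<union> D \<subseteq> V \<and>
     (\<forall>a\<in>A. \<forall>b\<in>B. \<forall>c\<in>C. \<forall>d\<in>D. induced_P4 E a b c d)"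

lemma P4_blowup_edges:
  assumes "simple_graph V E" "P4_blowup V E A B C D"
  shows "a \<in> A \<Longrightarrow> b \<in> B \<Longrightarrow> E a b \<and> E b a" "b \<in> B \<Longrightarrow> c \<in> C \<Longrightarrow> E b c \<and> E c b"
    "c \<in> C \<Longrightarrow> d \<in> D \<Longrightarrow> E c d \<and> E d c" "a \<in> A \<Longrightarrow> c \<in> C \<Longrightarrow> \<not> E a c \<and> \<not> E c a"
    "b \<in> B \<Longrightarrow> d \<in> D \<Longrightarrow> \<not> E b d \<and> \<not> E d b" "a \<in> A \<Longrightarrow> d \<in> D \<Longrightarrow> \<not> E a d \<and> \<not> E d a"
proof -
  have sub: "A \<union> B \<union> C \<union> D \<subseteq> V" and ne: "A \<noteq> {}" "B \<noteq> {}" "C \<noteq> {}" "D \<noteq> {}"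
    and P: "\<And>a b c d. a \<in> A \<Longrightarrow> b \<in> B \<Longrightarrow> c \<in> C \<Longrightarrow> d \<in> D \<Longrightarrow> induced_P4 E a b c d"
    using assms(2) by (auto simp: P4_blowup_def)
  have sym: "\<And>x y. x \<in> A \<union> B \<union> C \<union> D \<Longrightarrow> y \<in> A \<union> B \<union> C \<union> D \<Longrightarrow> E x y = E y x"
    using sub simple_graph_sym[OF assms(1)] by blast
  \<comment> \<open>Fixed representatives complete any pair to a transversal.\<close>
  obtain a' b' c' d' where "a' \<in> A" "b' \<in> B" "c' \<in> C" "d' \<in> D"
    using ne by blast
  note P' = P[unfolded induced_P4_def] this
  show "a \<in> A \<Longrightarrow> b \<in> B \<Longrightarrow> E a b \<and> E b a"
    using P'(2-) P'(1)[of a b c' d'] sym[of a b] by blast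
  show "b \<in> B \<Longrightarrow> c \<in> C \<Longrightarrow> E b c \<and> E c b"
    using P'(2-) P'(1)[of a' b c d'] sym[of b c] by blast
  show "c \<in> C \<Longrightarrow> d \<in> D \<Longrightarrow> E c d \<and> E d c"
    using P'(2-) P'(1)[of a' b' c d] sym[of c d] by blast
  show "a \<in> A \<Longrightarrow> c \<in> C \<Longrightarrow> \<not> E a c \<and> \<not> E c a"
    using P'(2-) P'(1)[of a b' c d'] sym[of a c] by blast
  show "b \<in> B \<Longrightarrow> d \<in> D \<Longrightarrow> \<not> E b d \<and> \<not> E d b"
    using P'(2-) P'(1)[of a' b c' d] sym[of b d] by blast
  show "a \<in> A \<Longrightarrow> d \<in> D \<Longrightarrow> \<not> E a d \<and> \<not> E d a"
    using P'(2-) P'(1)[of a b' c' d] sym[of a d] by blast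
qed

text \<open>This symmetry carries what is shown for \<open>A\<close> and \<open>B\<close> over to
  \<open>D\<close> and \<open>C\<close>.\<close>

lemma P4_blowup_rev:
  assumes "simple_graph V E" "P4_blowup V E A B C D"
  shows "P4_blowup V E D C B A"
  using assms(2) P4_blowup_edges[OF assms] by (auto simp: P4_blowup_def induced_P4_def)

lemma P4_blowup_disjoint:
  assumes "simple_graph V E" "P4_blowup V E A B C D"
  shows "A \<inter> B = {}" "A \<inter> C = {}" "A \<inter> D = {}" "B \<inter> C = {}" "B \<inter> D = {}" "C \<inter> D = {}"
proof -
  have "distinct [a, b, c, d]" if "a \<in> A" "b \<in> B" "c \<in> C" "d \<in> D" for a b c d
    using induced_P4_distinct[OF assms(1), of a b c d] assms(2) that by (auto simp: P4_blowup_def)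
  moreover have "A \<noteq> {}" "B \<noteq> {}" "C \<noteq> {}" "D \<noteq> {}"
    using assms(2) by (auto simp: P4_blowup_def)
  ultimately show "A \<inter> B = {}" "A \<inter> C = {}" "A \<inter> D = {}" "B \<inter> C = {}" "B \<inter> D = {}" "C \<inter> D = {}"
    by fastforce+
qed

text \<open>The outside vertices seeing \<open>A\<close> are those of \<open>B\<close>; those seeing
  \<open>B\<close> are all except \<open>D\<close>, because every vertex beyond the blow-up sees
  \<open>B\<close>.\<close>

lemma P4_blowup_modules:
  assumes sg: "simple_graph V E" and bl: "P4_blowup V E A B C D"
    and center: "\<And>s. s \<in> V - (A \<union> B \<union> C \<union> D) \<Longrightarrow>
      (\<forall>x\<in>B \<union> C. E s x) \<and> (\<forall>x\<in>A \<union> D. \<not> E s x)"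
  shows "is_module V E A \<and> is_module V E B"
proof
  note edges = P4_blowup_edges[OF sg bl]
  have sub: "A \<union> B \<union> C \<union> D \<subseteq> V"
    using bl by (auto simp: P4_blowup_def)
  show "is_module V E A"
  proof (rule is_moduleI[where N = B])
    show "E v m" if "v \<in> B - A" "m \<in> A" for v m
      using that edges(1)[of m v] by blast
    show "\<not> E v m" if "v \<in> V - A - B" "m \<in> A" for v m
      using that edges(4)[of m v] edges(6)[of m v] center[of v] by blast
  qed (use sub in blast)
  show "is_module V E B"
  proof (rule is_moduleI[where N = "V - D"])
    show "E v m" if "v \<in> V - D - B" "m \<in> B" for v m
      using that edges(1)[of v m] edges(2)[of m v] center[of v] by blast
    show "\<not> E v m" if "v \<in> V - B - (V - D)" "m \<in> B" for v m
      using that edges(5)[of m v] by blast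
  qed (use sub in blast)
qed

text \<open>Seeing one vertex of \<open>B\<close>, \<open>C\<close> or \<open>D\<close> is forced to
  extend to the whole set in the relevant cases. As \<open>s\<close> misses \<open>A\<close>, it
  then behaves like a vertex of \<open>A\<close>, \<open>C\<close> or \<open>D\<close>, or sees
  exactly \<open>B\<close> and \<open>C\<close>.\<close>

lemma P4_blowup_absorb:
  assumes sg: "simple_graph V E" and bl: "P4_blowup V E A B C D" and s: "s \<in> V"
    and ends: "\<And>a b c d v. induced_P4 E a b c d \<Longrightarrow> {a, b, c, d, v} \<subseteq> V \<Longrightarrow> \<not> (E v a \<and> E v d)"
    and mids: "\<And>a b c d v. induced_P4 E a b c d \<Longrightarrow> {a, b, c, d, v} \<subseteq> V \<Longrightarrow> E v b \<or> E v c"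
    and missA: "\<forall>a\<in>A. \<not> E s a"
  shows "P4_blowup V E (insert s A) B C D \<or> P4_blowup V E A B (insert s C) D \<or>
    P4_blowup V E A B C (insert s D) \<or>
    ((\<forall>x\<in>B \<union> C. E s x) \<and> (\<forall>x\<in>A \<union> D. \<not> E s x))"
proof -
  note edges = P4_blowup_edges[OF sg bl]
  have sub: "A \<union> B \<union> C \<union> D \<subseteq> V" and ne: "A \<noteq> {}" "B \<noteq> {}" "C \<noteq> {}" "D \<noteq> {}"
    and P: "\<And>a b c d. a \<in> A \<Longrightarrow> b \<in> B \<Longrightarrow> c \<in> C \<Longrightarrow> d \<in> D \<Longrightarrow> induced_P4 E a b c d"
    using bl by (auto simp: P4_blowup_def)
  have sym: "E s x = E x s" if "x \<in> A \<union> B \<union> C \<union> D" for x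
    using simple_graph_sym[OF sg] s sub that by blast
  obtain a d where a: "a \<in> A" and d: "d \<in> D"
    using ne by blast
  have BorC: "E s b \<or> E s c" if "b \<in> B" "c \<in> C" for b c
    using mids[OF P[OF a that d], of s] a d that s sub by auto
  \<comment> \<open>\<open>d'\<close> misses the midpoint \<open>b\<close> of the path
    \<open>a b s d''\<close>, so it must see the other midpoint \<open>s\<close>.\<close>
  have D: "E s d'" if h: "d'' \<in> D" "E s d''" "b \<in> B" "E s b" and d': "d' \<in> D" for b d' d''
  proof -
    have "induced_P4 E a b s d''"
      using h a edges missA sym by (auto simp: induced_P4_def)
    then have "E d' b \<or> E d' s"
      using mids[of a b s d'' d'] h a d' s sub by auto
    then show ?thesis
      using edges h d' sym by blast
  qed
  \<comment> \<open>On the path \<open>s b c d\<close>, \<open>c'\<close> sees the end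
    \<open>d\<close> and hence misses \<open>s\<close>.\<close>
  have C: "\<not> E s c'" if h: "c \<in> C" "\<not> E s c" "b \<in> B" "E s b" "\<not> E s d" and c': "c' \<in> C" for b c c'
  proof
    assume "E s c'"
    have "induced_P4 E s b c d"
      using h d edges by (auto simp: induced_P4_def)
    then have "\<not> (E c' s \<and> E c' d)"
      using ends[of s b c d c'] h c' d s sub by auto
    then show False
      using edges c' d sym \<open>E s c'\<close> by blast
  qed
  \<comment> \<open>On the path \<open>a b c s\<close>, \<open>b'\<close> sees the end
    \<open>a\<close> and hence misses \<open>s\<close>.\<close>
  have B: "\<not> E s b'" if h: "b \<in> B" "\<not> E s b" "c \<in> C" "E s c" and b': "b' \<in> B" for b c b'
  proof
    assume "E s b'"
    have "induced_P4 E a b c s"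
      using h a edges missA sym by (auto simp: induced_P4_def)
    then have "\<not> (E b' a \<and> E b' s)"
      using ends[of a b c s b'] h b' a s sub by auto
    then show False
      using edges b' a sym \<open>E s b'\<close> by blast
  qed
  show ?thesis
  proof (cases "\<forall>b\<in>B. E s b")
    case allB: True
    show ?thesis
    proof (cases "\<exists>d\<in>D. E s d")
      case True
      then have "\<forall>d\<in>D. E s d"
        using D allB ne by blast
      then have "P4_blowup V E A B (insert s C) D"
        using bl s allB missA sym unfolding P4_blowup_def induced_P4_def by auto
      then show ?thesis by blast
    next
      case missD: False
      show ?thesis
      proof (cases "\<forall>c\<in>C. E s c")
        case True
        then show ?thesis using allB missA missD by blast
      next
        case False
        then have "\<forall>c\<in>C. \<not> E s c"
          using C allB missD d ne by blast
        then have "P4_blowup V E (insert s A) B C D"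
          using bl s allB missD sym unfolding P4_blowup_def induced_P4_def by auto
        then show ?thesis by blast
      qed
    qed
  next
    case False
    then have allC: "\<forall>c\<in>C. E s c"
      using BorC by blast
    then have "\<forall>b\<in>B. \<not> E s b"
      using False B ne by blast
    then have "P4_blowup V E A B C (insert s D)"
      using bl s allC missA sym unfolding P4_blowup_def induced_P4_def by auto
    then show ?thesis by blast
  qed
qed

section \<open>Recognition of the two prime graphs\<close>

lemma graph_iso_P4:
  assumes "simple_graph V E" "V = {a, b, c, d}" "induced_P4 E a b c d"
  shows "graph_iso V E {0..<4} P4"
proof -
  have dist: "distinct [a, b, c, d]"
    using induced_P4_distinct[OF assms(1) _ assms(3)] assms(2) by simp
  have sym: "E b a" "E c b" "E d c" "\<not> E c a" "\<not> E d b" "\<not> E d a"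
    using assms(2,3) simple_graph_sym[OF assms(1)] by (auto simp: induced_P4_def)
  have loops: "\<not> E a a" "\<not> E b b" "\<not> E c c" "\<not> E d d"
    using assms(2) simple_graph_irrefl[OF assms(1)] by auto
  have set4: "{0..<4} = {0, 1, 2, 3 :: nat}"
    by (simp add: atLeast0LessThan eval_nat_numeral lessThan_Suc insert_commute)
  show ?thesis
    unfolding graph_iso_def
    by (rule exI[of _ "\<lambda>x. if x = a then 0 else if x = b then 1 else if x = c then 2 else 3"])
      (use dist sym loops assms in \<open>auto simp: P4_def edges_of_def induced_P4_def bij_betw_def
        inj_on_def set4\<close>)
qed

lemma graph_iso_bull:
  assumes "simple_graph V E" "V = {a, b, c, d, s}" "induced_P4 E a b c d"
    and "E s b" "E s c" "\<not> E s a" "\<not> E s d"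
  shows "graph_iso V E {0..<5} bull"
proof -
  have dist4: "distinct [a, b, c, d]"
    using induced_P4_distinct[OF assms(1) _ assms(3)] assms(2) by simp
  have sym: "E b a" "E c b" "E d c" "\<not> E c a" "\<not> E d b" "\<not> E d a"
      "E b s" "E c s" "\<not> E a s" "\<not> E d s"
    using assms(2-) simple_graph_sym[OF assms(1)] by (auto simp: induced_P4_def)
  have loops: "\<not> E a a" "\<not> E b b" "\<not> E c c" "\<not> E d d" "\<not> E s s"
    using assms(2) simple_graph_irrefl[OF assms(1)] by auto
  have dist: "distinct [a, b, c, d, s]"
    using dist4 assms(3-) sym loops by (auto simp: induced_P4_def)
  \<comment> \<open>The triangle \<open>b c s\<close> goes to 0, 1, 2; the pendant vertices
    \<open>a\<close> at \<open>b\<close> and \<open>d\<close> at \<open>c\<close> go to 3 and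
    4.\<close>
  show ?thesis
    unfolding graph_iso_def
    by (rule exI[of _ "\<lambda>x. if x = b then 0 else if x = c then 1 else if x = s then 2
        else if x = a then 3 else 4"])
      (use dist sym loops assms in \<open>auto simp: bull_def edges_of_def induced_P4_def bij_betw_def
        inj_on_def five_vertex_set\<close>)
qed

text \<open>Every graph on at most two vertices satisfies \<open>prime_graph\<close>; the bound on
  \<open>card V\<close> sets these aside.\<close>

theorem theorem1:
  fixes V :: "'a set" and E :: "'a \<Rightarrow> 'a \<Rightarrow> bool"
  assumes "simple_graph V E"
    and "card V \<ge> 3"
    and "prime_graph V E"
    and "distance_hereditary V E"
    and "distance_hereditary V (compl_graph E)"
  shows "graph_iso V E {0..<4} P4 \<or> graph_iso V E {0..<5} bull"
proof -
  note sg = assms(1)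
  have fin: "finite V"
    using sg by (simp add: simple_graph_def)
  have ends: "\<not> (E v a \<and> E v d)" if "induced_P4 E a b c d" "{a, b, c, d, v} \<subseteq> V" for a b c d v
    using dh_P4_ends[OF sg assms(4) that(1)] that(2) by auto
  have mids: "E v b \<or> E v c" if "induced_P4 E a b c d" "{a, b, c, d, v} \<subseteq> V" for a b c d v
    using co_dh_P4_mids[OF sg assms(5) that(1)] that(2) by auto
  let ?bl = "\<lambda>(A, B, C, D). P4_blowup V E A B C D"
  let ?size = "\<lambda>(A, B, C, D). card (A \<union> B \<union> C \<union> D)"
  obtain a b c d where "{a, b, c, d} \<subseteq> V" "induced_P4 E a b c d"
    using prime_graph_has_P4[OF assms(1-3)] by blast
  then have "?bl ({a}, {b}, {c}, {d})"
    by (auto simp: P4_blowup_def)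
  \<comment> \<open>A uniform strict bound on the sizes yields a blow-up of maximum size.\<close>
  moreover have "\<forall>X. ?bl X \<longrightarrow> ?size X < Suc (card V)"
    using fin by (auto simp: P4_blowup_def less_Suc_eq_le intro!: card_mono)
  ultimately obtain X where "?bl X \<and> (\<forall>Y. ?bl Y \<longrightarrow> ?size Y \<le> ?size X)"
    using ex_has_greatest_nat[of ?bl _ ?size] by blast
  then obtain A B C D where bl: "P4_blowup V E A B C D"
    and maximal: "\<And>A' B' C' D'. P4_blowup V E A' B' C' D' \<Longrightarrow>
      card (A' \<union> B' \<union> C' \<union> D') \<le> card (A \<union> B \<union> C \<union> D)"
    by (cases X) fastforce
  let ?U = "A \<union> B \<union> C \<union> D"
  let ?S = "V - ?U"
  have sub: "?U \<subseteq> V" and ne: "A \<noteq> {}" "B \<noteq> {}" "C \<noteq> {}" "D \<noteq> {}"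
    using bl by (auto simp: P4_blowup_def)
  note disj = P4_blowup_disjoint[OF sg bl]
  have finU: "finite ?U"
    using sub fin by (rule finite_subset)
  have no_larger: "\<not> P4_blowup V E A' B' C' D'"
    if "A' \<union> B' \<union> C' \<union> D' = insert s ?U" "s \<in> ?S" for A' B' C' D' s
  proof
    assume "P4_blowup V E A' B' C' D'"
    from maximal[OF this] have "card (insert s ?U) \<le> card ?U"
      unfolding that(1) .
    moreover have "card (insert s ?U) = Suc (card ?U)"
      using finU that(2) by (intro card_insert_disjoint) auto
    ultimately show False by simp
  qed
  have center: "(\<forall>x\<in>B \<union> C. E s x) \<and> (\<forall>x\<in>A \<union> D. \<not> E s x)" if s: "s \<in> ?S" for s
  proof -
    have sV: "s \<in> V"
      using s by simp
    \<comment> \<open>By the rule on ends \<open>s\<close> misses \<open>A\<close> or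
      \<open>D\<close>, so absorption applies to the blow-up or to its reversal.\<close>
    have "(\<forall>a\<in>A. \<not> E s a) \<or> (\<forall>d\<in>D. \<not> E s d)"
    proof (rule ccontr)
      assume "\<not> ?thesis"
      then obtain a d where ad: "a \<in> A" "d \<in> D" "E s a" "E s d"
        by blast
      obtain b c where bc: "b \<in> B" "c \<in> C"
        using ne by blast
      have "induced_P4 E a b c d"
        using bl ad bc by (auto simp: P4_blowup_def)
      then show False
        using ends[of a b c d s] ad bc sub sV by auto
    qed
    then show ?thesis
    proof
      assume "\<forall>a\<in>A. \<not> E s a"
      from P4_blowup_absorb[OF sg bl sV ends mids this] show ?thesis
        using no_larger[OF _ s] by (auto simp: Un_ac)
    next
      assume "\<forall>d\<in>D. \<not> E s d"
      from P4_blowup_absorb[OF sg P4_blowup_rev[OF sg bl] sV ends mids this] show ?thesis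
        using no_larger[OF _ s] by (auto simp: Un_ac)
    qed
  qed
  have center': "(\<forall>x\<in>B \<union> C. E x s) \<and> (\<forall>x\<in>A \<union> D. \<not> E x s)" if "s \<in> ?S" for s
    using center[OF that] that sub simple_graph_sym[OF sg] by blast
  have "is_module V E A \<and> is_module V E B"
    using P4_blowup_modules[OF sg bl] center by blast
  moreover have "is_module V E D \<and> is_module V E C"
    using P4_blowup_modules[OF sg P4_blowup_rev[OF sg bl]] center
    by (simp add: Un_ac)
  moreover have "A \<noteq> V" "B \<noteq> V" "C \<noteq> V" "D \<noteq> V"
    using ne disj sub by blast+
  ultimately have "card A = 1" "card B = 1" "card C = 1" "card D = 1"
    using prime_graphD[OF assms(3)] ne by blast+
  then obtain a b c d where single: "A = {a}" "B = {b}" "C = {c}" "D = {d}"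
    by (auto simp: card_1_singleton_iff)
  have P: "induced_P4 E a b c d"
    using bl single by (simp add: P4_blowup_def)
  \<comment> \<open>All vertices of \<open>?S\<close> see the same part of the blow-up, namely
    \<open>B\<close> and \<open>C\<close>; edges inside \<open>?S\<close> do not matter.\<close>
  have "is_module V E ?S"
    by (rule is_moduleI[where N = "B \<union> C"]) (use center' in auto)
  moreover have "?S \<noteq> V"
    using sub ne by blast
  ultimately consider "?S = {}" | "card ?S = 1"
    using prime_graphD[OF assms(3)] by blast
  then show ?thesis
  proof cases
    case 1
    then have "V = {a, b, c, d}"
      using sub single by auto
    then show ?thesis
      using graph_iso_P4[OF sg _ P] by blast
  next
    case 2
    then obtain s where s: "?S = {s}"
      by (auto simp: card_1_singleton_iff)
    then have "V = {a, b, c, d, s}"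
      using sub single by auto
    moreover have "E s b" "E s c" "\<not> E s a" "\<not> E s d"
      using center[of s] s single by blast+
    ultimately show ?thesis
      using graph_iso_bull[OF sg _ P] by blast
  qed
qed

end
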